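(* Let $p>0$, $\epsilon>0$, let $\sigma$ be a finite nonzero Borel measure on $\mathbb S^{d-1}$, and let $q$, $\{Q_s\}_{s\in\mathbb S^{d-1}}$, $\ell$, $k_\epsilon$, $\lambda^\epsilon$, $\tilde\nu^\epsilon_p$, $\sigma_p$, $G_V$, $G_R$ be as defined in the context. Let $S\sim\sigma_p$. Given $S$, let $V\sim G_V(\cdot;S)$ and, given $S$ and $V$, let $R\sim G_R(\cdot;V^{1/p}\epsilon)$. If $W=RV^{-1/p}S$, then $W\sim\tilde\nu^\epsilon_p$.
   Context: $\mathbb S^{d-1}$ is the unit sphere in $\mathbb R^d$; $\mathfrak B(\cdot)$ denotes Borel sets. A L\'evy measure is a Borel measure $M$ on $\mathbb R^d$ with $M(\{0\})=0$ and $\int(|x|^2\wedge1)M(\mathrm dx)<\infty$. Setting (general multivariate gamma distributions): $q:(0,\infty)\times\mathbb S^{d-1}\to[0,\infty)$ is a Borel function such that for each $s\in\mathbb S^{d-1}$, $\lim_{r\downarrow0}q(r,s)=1$ and $q(\cdot,s)$ is completely monotone, and the measure $$\nu(B)=\int_{\mathbb S^{d-1}}\int_0^\infty1_B(rs)\,q(r^p,s)\,r^{-1}\,\mathrm dr\,\sigma(\mathrm ds),\quad B\in\mathfrak B(\mathbb R^d),$$ is a L\'evy measure with $\int(|x|\wedge1)\nu(\mathrm dx)<\infty$. Then $q(r^p,s)=\int_{(0,\infty)}e^{-r^pv}Q_s(\mathrm dv)$ for a measurable family $\{Q_s\}_{s\in\mathbb S^{d-1}}$ of probability measures on $(0,\infty)$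 satisfying $\int_{\mathbb S^{d-1}}\int_0^1\log(1/v)\,Q_s(\mathrm dv)\,\sigma(\mathrm ds)<\infty$. Definitions: - $\tilde\nu^\epsilon(B)=\int_{\mathbb S^{d-1}}\int_\epsilon^\infty1_B(rs)\,q(r^p,s)\,r^{-1}\,\mathrm dr\,\sigma(\mathrm ds)$ for $B\in\mathfrak B(\mathbb R^d)$, which is a finite measure; $\lambda^\epsilon=\tilde\nu^\epsilon(\mathbb R^d)$; and $\tilde\nu^\epsilon_p=\tilde\nu^\epsilon/\lambda^\epsilon$, a probability measure. - $\ell(u)=\int_u^\infty r^{-1}e^{-r^p}\,\mathrm dr$ for $u>0$. - $k_\epsilon(s)=\int_\epsilon^\infty q(r^p,s)\,r^{-1}\,\mathrm dr=\int_0^\infty\ell(\epsilon v^{1/p})\,Q_s(\mathrm dv)$ for $s\in\mathbb S^{d-1}$. - $\sigma_p(\mathrm ds)=\frac{k_\epsilon(s)}{\lambda^\epsilon}\sigma(\mathrm ds)$, a probability measure on $\mathbb S^{d-1}$. - $G_V(\mathrm dv;s)=\frac{\ell(\epsilon v^{1/p})}{k_\epsilon(s)}Q_s(\mathrm dv)$, a family of probability measures on $(0,\infty)$ with parameter $s\in\mathbb S^{d-1}$. - $G_R(\mathrm dr;a)=g_R(r;a)\,\mathrm dr$ with $g_R(r;a)=\frac1{\ell(a)}r^{-1}e^{-r^p}1_{[r\ge a]}$, a family of probability measures on $(0,\infty)$ with parameter $a>0$. *)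

theory Defs
  imports "HOL-Probability.Probability"
begin

abbreviation borel_sphere :: "'a::euclidean_space measure" where
  "borel_sphere \<equiv> restrict_space borel (sphere 0 1)"

abbreviation borel_pos :: "real measure" where
  "borel_pos \<equiv> restrict_space borel {0<..}"

(* The iterated derivatives at r > 0 only depend on f restricted to the positive half-line. *)
definition completely_monotone :: "(real \<Rightarrow> real) \<Rightarrow> bool" where
  "completely_monotone f \<longleftrightarrow>
     (\<forall>n. \<forall>r>0. (deriv ^^ n) f differentiable (at r) \<and> 0 \<le> (-1) ^ n * (deriv ^^ n) f r)"

definition levy_measure :: "'a::euclidean_space measure \<Rightarrow> bool" where
  "levy_measure M \<longleftrightarrow> sets M = sets borel \<and> emeasure M {0} = 0 \<and>
     (\<integral>\<^sup>+ x. ennreal (min ((norm x)\<^sup>2) 1) \<partial>M) < \<infinity>"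

(* For E in sets B:  P(Y in E | sigma(X)) = K(X)(E)  almost surely. *)
definition has_cond_distr ::
  "'w measure \<Rightarrow> ('w \<Rightarrow> 'x) \<Rightarrow> 'x measure \<Rightarrow> ('w \<Rightarrow> 'y) \<Rightarrow> 'y measure \<Rightarrow> ('x \<Rightarrow> 'y measure) \<Rightarrow> bool"
where
  "has_cond_distr P X A Y B K \<longleftrightarrow> X \<in> P \<rightarrow>\<^sub>M A \<and> Y \<in> P \<rightarrow>\<^sub>M B \<and>
     (\<forall>E\<in>sets B. AE \<omega> in P.
        nn_cond_exp P (vimage_algebra (space P) X A) (indicator (Y -` E \<inter> space P)) \<omega>
          = emeasure (K (X \<omega>)) E)"

(* The measure with polar decomposition q(r^p,s) r^(-1) dr sigma(ds), radii restricted to I. *)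
definition polar_measure ::
  "real \<Rightarrow> 'a::euclidean_space measure \<Rightarrow> (real \<Rightarrow> 'a \<Rightarrow> real) \<Rightarrow> real set \<Rightarrow> 'a measure"
where
  "polar_measure p \<sigma> q I = measure_of UNIV (sets borel)
     (\<lambda>B. \<integral>\<^sup>+ s. (\<integral>\<^sup>+ r\<in>I. indicator B (r *\<^sub>R s) * ennreal (q (r powr p) s / r) \<partial>lborel) \<partial>\<sigma>)"

definition gamma_nu ::
  "real \<Rightarrow> 'a::euclidean_space measure \<Rightarrow> (real \<Rightarrow> 'a \<Rightarrow> real) \<Rightarrow> 'a measure"
where
  "gamma_nu p \<sigma> q = polar_measure p \<sigma> q {0<..}"

definition nu_tilde ::
  "real \<Rightarrow> real \<Rightarrow> 'a::euclidean_space measure \<Rightarrow> (real \<Rightarrow> 'a \<Rightarrow> real) \<Rightarrow> 'a measure"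
where
  "nu_tilde p \<epsilon> \<sigma> q = polar_measure p \<sigma> q {\<epsilon>..}"

definition lam ::
  "real \<Rightarrow> real \<Rightarrow> 'a::euclidean_space measure \<Rightarrow> (real \<Rightarrow> 'a \<Rightarrow> real) \<Rightarrow> ennreal"
where
  "lam p \<epsilon> \<sigma> q = emeasure (nu_tilde p \<epsilon> \<sigma> q) UNIV"

definition nu_tilde_prob ::
  "real \<Rightarrow> real \<Rightarrow> 'a::euclidean_space measure \<Rightarrow> (real \<Rightarrow> 'a \<Rightarrow> real) \<Rightarrow> 'a measure"
where
  "nu_tilde_prob p \<epsilon> \<sigma> q = scale_measure (1 / lam p \<epsilon> \<sigma> q) (nu_tilde p \<epsilon> \<sigma> q)"

definition ell :: "real \<Rightarrow> real \<Rightarrow> ennreal" where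
  "ell p u = (\<integral>\<^sup>+ r\<in>{u..}. ennreal (exp (- (r powr p)) / r) \<partial>lborel)"

(* May be infinite on a sigma-null set of directions s; there G_V below is the zero measure. *)
definition k_eps :: "real \<Rightarrow> real \<Rightarrow> (real \<Rightarrow> 'a \<Rightarrow> real) \<Rightarrow> 'a \<Rightarrow> ennreal" where
  "k_eps p \<epsilon> q s = (\<integral>\<^sup>+ r\<in>{\<epsilon>..}. ennreal (q (r powr p) s / r) \<partial>lborel)"

definition sigma_p ::
  "real \<Rightarrow> real \<Rightarrow> 'a::euclidean_space measure \<Rightarrow> (real \<Rightarrow> 'a \<Rightarrow> real) \<Rightarrow> 'a measure"
where
  "sigma_p p \<epsilon> \<sigma> q = density \<sigma> (\<lambda>s. k_eps p \<epsilon> q s / lam p \<epsilon> \<sigma> q)"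

definition G_V ::
  "real \<Rightarrow> real \<Rightarrow> (real \<Rightarrow> 'a \<Rightarrow> real) \<Rightarrow> ('a \<Rightarrow> real measure) \<Rightarrow> 'a \<Rightarrow> real measure"
where
  "G_V p \<epsilon> q Q s = density (Q s) (\<lambda>v. ell p (\<epsilon> * v powr (1 / p)) / k_eps p \<epsilon> q s)"

definition G_R :: "real \<Rightarrow> real \<Rightarrow> real measure" where
  "G_R p a = density (restrict_space lborel {0<..})
     (\<lambda>r. indicator {a..} r * ennreal (exp (- (r powr p)) / r) / ell p a)"

(* The set function defining polar_measure is countably additive, so that measure_of
   does not degenerate. *)
lemma polar_measure_integrand_measurable:
  fixes \<sigma> :: "'a::euclidean_space measure"
  assumes sig: "sets \<sigma> = sets borel_sphere"
    and q: "(\<lambda>(r, s). q r s) \<in> borel_measurable (borel_pos \<Otimes>\<^sub>M borel_sphere)"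
    and I: "I \<in> sets borel" "I \<subseteq> {0<..}"
    and B: "B \<in> sets borel"
  shows "(\<lambda>(s, r). indicator B (r *\<^sub>R s) * ennreal (q (r powr p) s / r) * indicator I r)
           \<in> borel_measurable (\<sigma> \<Otimes>\<^sub>M lborel)"
proof -
  let ?T = "\<lambda>r::real. if r \<in> I then r powr p else 1"
  have [measurable_cong]: "sets \<sigma> = sets borel_sphere" by (fact sig)
  have [measurable]: "I \<in> sets borel" "B \<in> sets borel" using I B by auto
  have spos: "?T r > 0" for r using I by auto
  have T[measurable]: "?T \<in> lborel \<rightarrow>\<^sub>M borel_pos"
    by (rule measurable_restrict_space2) (use spos in auto)
  have id: "(\<lambda>s. s) \<in> \<sigma> \<rightarrow>\<^sub>M borel"
    unfolding measurable_cong_sets[OF sig refl] by (rule measurable_restrict_space1) simp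
  have sc[measurable]: "(\<lambda>x. snd x *\<^sub>R fst x) \<in> borel_measurable (\<sigma> \<Otimes>\<^sub>M lborel)"
    using id by measurable
  have pr: "(\<lambda>x. (?T (snd x), fst x)) \<in> \<sigma> \<Otimes>\<^sub>M lborel \<rightarrow>\<^sub>M borel_pos \<Otimes>\<^sub>M borel_sphere"
    by measurable
  have Q[measurable]: "(\<lambda>x. q (?T (snd x)) (fst x)) \<in> borel_measurable (\<sigma> \<Otimes>\<^sub>M lborel)"
    using measurable_compose[OF pr q] by simp
  have "(\<lambda>x. indicator B (snd x *\<^sub>R fst x) * ennreal (q (?T (snd x)) (fst x) / snd x)
            * indicator I (snd x)) \<in> borel_measurable (\<sigma> \<Otimes>\<^sub>M lborel)"
    by measurable
  also have "(\<lambda>x. indicator B (snd x *\<^sub>R fst x) * ennreal (q (?T (snd x)) (fst x) / snd x)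
            * indicator I (snd x)) =
     (\<lambda>(s, r). indicator B (r *\<^sub>R s) * ennreal (q (r powr p) s / r) * indicator I r)"
    by (auto simp: fun_eq_iff split: split_indicator)
  finally show ?thesis .
qed

lemma emeasure_polar_measure:
  fixes \<sigma> :: "'a::euclidean_space measure"
  assumes sig: "sets \<sigma> = sets borel_sphere"
    and q: "(\<lambda>(r, s). q r s) \<in> borel_measurable (borel_pos \<Otimes>\<^sub>M borel_sphere)"
    and I: "I \<in> sets borel" "I \<subseteq> {0<..}"
    and B: "B \<in> sets borel"
  shows "emeasure (polar_measure p \<sigma> q I) B =
     (\<integral>\<^sup>+ s. (\<integral>\<^sup>+ r\<in>I. indicator B (r *\<^sub>R s) * ennreal (q (r powr p) s / r) \<partial>lborel) \<partial>\<sigma>)"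
proof -
  define f where
    "f B s r = indicator B (r *\<^sub>R s) * ennreal (q (r powr p) s / r) * indicator I r"
    for B :: "'a set" and s r
  have f: "(\<lambda>(s, r). f B s r) \<in> borel_measurable (\<sigma> \<Otimes>\<^sub>M lborel)" if "B \<in> sets borel" for B
    unfolding f_def by (rule polar_measure_integrand_measurable[OF sig q I that])
  have f1: "f B s \<in> borel_measurable lborel" if "B \<in> sets borel" "s \<in> space \<sigma>" for B s
    using measurable_compose[OF measurable_Pair1'[OF that(2)] f[OF that(1)]] by simp
  have f2: "(\<lambda>s. \<integral>\<^sup>+ r. f B s r \<partial>lborel) \<in> borel_measurable \<sigma>" if "B \<in> sets borel" for B
    by (rule lborel.borel_measurable_nn_integral[OF f[OF that]])
  let ?m = "\<lambda>B. \<integral>\<^sup>+ s. (\<integral>\<^sup>+ r. f B s r \<partial>lborel) \<partial>\<sigma>"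
  have eq: "polar_measure p \<sigma> q I = measure_of UNIV (sets borel) ?m"
    unfolding polar_measure_def f_def ..
  have "emeasure (polar_measure p \<sigma> q I) B = ?m B"
  proof (rule emeasure_measure_of[OF eq])
    show "positive (sets (polar_measure p \<sigma> q I)) ?m"
      by (simp add: positive_def f_def)
    show "countably_additive (sets (polar_measure p \<sigma> q I)) ?m"
    proof (rule countably_additiveI)
      fix A :: "nat \<Rightarrow> 'a set"
      assume A: "range A \<subseteq> sets (polar_measure p \<sigma> q I)" "disjoint_family A"
      have sA: "A i \<in> sets borel" for i
        using A(1) sets.sigma_sets_eq[of "borel :: 'a measure"] by (auto simp: polar_measure_def)
      have "f (\<Union>i. A i) s r = (\<Sum>i. f (A i) s r)" for s r
        unfolding f_def by (simp add: suminf_indicator[OF A(2), symmetric] ennreal_suminf_multc)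
      then have "?m (\<Union>i. A i) = (\<integral>\<^sup>+ s. (\<integral>\<^sup>+ r. (\<Sum>i. f (A i) s r) \<partial>lborel) \<partial>\<sigma>)"
        by simp
      also have "\<dots> = (\<integral>\<^sup>+ s. (\<Sum>i. \<integral>\<^sup>+ r. f (A i) s r \<partial>lborel) \<partial>\<sigma>)"
        by (intro nn_integral_cong nn_integral_suminf f1 sA)
      also have "\<dots> = (\<Sum>i. ?m (A i))"
        by (intro nn_integral_suminf f2 sA)
      finally show "(\<Sum>i. ?m (A i)) = ?m (\<Union>i. A i)" ..
    qed
  qed (use B sets.sigma_sets_eq[of "borel :: 'a measure"] in \<open>auto simp: polar_measure_def\<close>)
  then show ?thesis by (simp add: f_def)
qed

end

theory Submission
  imports Defs
begin

text \<open>Test the law of \<open>W\<close> on a Borel set \<open>B\<close>. Given \<open>S = s\<close> and \<open>V = v\<close>, the substitution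
  \<open>r = v\<^sup>1\<^sup>/\<^sup>p t\<close> turns the integral over \<open>R\<close> into
  \<open>\<integral>\<^sub>\<epsilon>\<^sup>\<infinity> 1\<^sub>B(ts) exp(-v t\<^sup>p) dt/t\<close> divided by \<open>\<ell>(\<epsilon> v\<^sup>1\<^sup>/\<^sup>p)\<close>. This normalisation cancels the
  density of \<open>G\<^sub>V\<close>, so integrating over \<open>v\<close> replaces the exponential by \<open>q(t\<^sup>p, s)\<close>; the remaining
  factor \<open>1/k\<^sub>\<epsilon>(s)\<close> cancels the density of \<open>\<sigma>\<^sub>p\<close>.\<close>

section \<open>Conditional distributions: disintegration of a joint law along a kernel\<close>

text \<open>\<open>has_cond_distr\<close> fixes the conditional law one event at a time, with an
  exceptional null set that may depend on the event. This suffices: it determines the joint law on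
  measurable rectangles, which form an intersection-stable generator, so the joint law is the bind
  of the law of \<open>X\<close> with \<open>K\<close>. Measurability of \<open>K\<close> makes this
  bind meaningful and turns integrals against it into iterated ones.\<close>

lemma has_cond_distr_nn_integral:
  assumes P: "prob_space P" and cd: "has_cond_distr P X A Y B K"
    and K: "K \<in> A \<rightarrow>\<^sub>M subprob_algebra B"
    and F: "F \<in> borel_measurable (A \<Otimes>\<^sub>M B)"
  shows "(\<integral>\<^sup>+ \<omega>. F (X \<omega>, Y \<omega>) \<partial>P) = (\<integral>\<^sup>+ x. (\<integral>\<^sup>+ y. F (x, y) \<partial>K x) \<partial>distr P A X)"
proof -
  interpret prob_space P by (fact P)
  have X[measurable]: "X \<in> P \<rightarrow>\<^sub>M A" and Y[measurable]: "Y \<in> P \<rightarrow>\<^sub>M B"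
    and cond: "\<And>E. E \<in> sets B \<Longrightarrow> AE \<omega> in P.
        nn_cond_exp P (vimage_algebra (space P) X A) (indicator (Y -` E \<inter> space P)) \<omega>
          = emeasure (K (X \<omega>)) E"
    using cd unfolding has_cond_distr_def by auto
  let ?G = "vimage_algebra (space P) X A"
  have "subalgebra P ?G"
    unfolding subalgebra_def using measurable_iff_sets[of X P A] X by simp
  then interpret G: finite_measure_subalgebra P ?G
    by (intro finite_measure_subalgebra.intro finite_measure_subalgebra_axioms.intro finite_measure_axioms)
  let ?D = "distr P (A \<Otimes>\<^sub>M B) (\<lambda>\<omega>. (X \<omega>, Y \<omega>))"
  let ?L = "\<lambda>x. distr (K x) (A \<Otimes>\<^sub>M B) (Pair x)"
  let ?M = "distr P A X \<bind> ?L"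
  have L: "?L \<in> distr P A X \<rightarrow>\<^sub>M subprob_algebra (A \<Otimes>\<^sub>M B)"
    by (rule measurable_distr2[where M=B]) (use K in auto)
  have ne: "space (distr P A X) \<noteq> {}"
    using not_empty measurable_space[OF X] by auto
  have spK: "sets (K x) = sets B" if "x \<in> space A" for x
    using measurable_space[OF K that] by (simp add: space_subprob_algebra)
  have eq: "?D = ?M"
  proof (rule measure_eqI_generator_eq[OF Int_stable_pair_measure_generator[of A B]])
    let ?E = "{a \<times> b | a b. a \<in> sets A \<and> b \<in> sets B}"
    show "?E \<subseteq> Pow (space A \<times> space B)"
      using sets.space_closed[of A] sets.space_closed[of B] by auto
    show "sets ?D = sigma_sets (space A \<times> space B) ?E"
      by (simp add: sets_pair_measure)
    show "sets ?M = sigma_sets (space A \<times> space B) ?E"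
      using ne by (subst sets_bind[of _ _ "A \<Otimes>\<^sub>M B"]) (auto simp: sets_pair_measure)
    show "range (\<lambda>_::nat. space A \<times> space B) \<subseteq> ?E" "(\<Union>i::nat. space A \<times> space B) = space A \<times> space B"
      by auto
    show "emeasure ?D (space A \<times> space B) \<noteq> \<infinity>"
      by (simp add: emeasure_distr)
    fix Z assume "Z \<in> ?E"
    then obtain a b where Z: "Z = a \<times> b" and [measurable]: "a \<in> sets A" "b \<in> sets B" by auto
    \<comment> \<open>This factor is measurable for the sigma-algebra generated by \<open>X\<close>.
      Under the integral, the indicator of the event that \<open>Y\<close> lies in \<open>b\<close>
      may therefore be replaced by its conditional expectation, which \<open>cond\<close> identifies
      with the kernel.\<close>
    have ia: "(\<lambda>\<omega>. indicator a (X \<omega>) :: ennreal) \<in> borel_measurable ?G"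
      using measurable_space[OF X]
      by (intro measurable_compose[OF measurable_vimage_algebra1 borel_measurable_indicator]) auto
    have "emeasure ?D Z = (\<integral>\<^sup>+ \<omega>. indicator a (X \<omega>) * indicator (Y -` b \<inter> space P) \<omega> \<partial>P)"
      unfolding Z by (subst nn_integral_indicator[symmetric], simp, subst nn_integral_distr)
        (auto intro!: nn_integral_cong split: split_indicator)
    also have "\<dots> = (\<integral>\<^sup>+ \<omega>. indicator a (X \<omega>) *
        nn_cond_exp P ?G (indicator (Y -` b \<inter> space P)) \<omega> \<partial>P)"
      by (rule G.nn_cond_exp_intg[symmetric, OF ia]) measurable
    also have "\<dots> = (\<integral>\<^sup>+ \<omega>. indicator a (X \<omega>) * emeasure (K (X \<omega>)) b \<partial>P)"
      by (rule nn_integral_cong_AE) (use cond[of b] in auto)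
    also have "\<dots> = (\<integral>\<^sup>+ x. indicator a x * emeasure (K x) b \<partial>distr P A X)"
      by (subst nn_integral_distr) (auto intro!: borel_measurable_times_ennreal
        borel_measurable_indicator measurable_emeasure_kernel[OF K])
    also have "\<dots> = (\<integral>\<^sup>+ x. emeasure (?L x) Z \<partial>distr P A X)"
    proof (rule nn_integral_cong)
      fix x assume "x \<in> space (distr P A X)"
      then have x: "x \<in> space A" by simp
      have [measurable_cong]: "sets (K x) = sets B" by (rule spK[OF x])
      have "emeasure (?L x) Z = emeasure (K x) (Pair x -` Z \<inter> space (K x))"
        unfolding Z using x by (subst emeasure_distr) auto
      also have "Pair x -` Z \<inter> space (K x) = (if x \<in> a then b else {})"
        unfolding Z using sets.sets_into_space[OF \<open>b \<in> sets B\<close>] sets_eq_imp_space_eq[OF spK[OF x]] by auto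
      finally show "indicator a x * emeasure (K x) b = emeasure (?L x) Z" by simp
    qed
    also have "\<dots> = emeasure ?M Z"
      unfolding Z by (rule emeasure_bind[symmetric, OF ne L]) auto
    finally show "emeasure ?D Z = emeasure ?M Z" .
  qed
  have "(\<integral>\<^sup>+ \<omega>. F (X \<omega>, Y \<omega>) \<partial>P) = (\<integral>\<^sup>+ z. F z \<partial>?D)"
    using F by (subst nn_integral_distr) auto
  also have "\<dots> = (\<integral>\<^sup>+ x. (\<integral>\<^sup>+ z. F z \<partial>?L x) \<partial>distr P A X)"
    unfolding eq by (rule nn_integral_bind[OF F L])
  also have "\<dots> = (\<integral>\<^sup>+ x. (\<integral>\<^sup>+ y. F (x, y) \<partial>K x) \<partial>distr P A X)"
  proof (rule nn_integral_cong)
    fix x assume "x \<in> space (distr P A X)"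
    then have x: "x \<in> space A" by simp
    have [measurable_cong]: "sets (K x) = sets B" by (rule spK[OF x])
    show "(\<integral>\<^sup>+ z. F z \<partial>?L x) = (\<integral>\<^sup>+ y. F (x, y) \<partial>K x)"
      using F x by (subst nn_integral_distr) auto
  qed
  finally show ?thesis .
qed

section \<open>Cancellation in the extended reals, and the function \<open>ell\<close>\<close>

text \<open>Division is multiplication by the inverse, so only the cancelled \<open>c\<close> has to
  be positive and finite; \<open>a\<close> and \<open>b\<close> may be 0 or infinite. It serves
  twice: with \<open>c\<close> a value of \<open>ell\<close> and \<open>a\<close> a possibly
  infinite value of \<open>k_eps\<close>, and with \<open>c\<close> a value of \<open>k_eps\<close>
  and \<open>a\<close> equal to \<open>lam\<close>.\<close>

lemma ennreal_divide_mult_divide_cancel: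
  fixes a b c :: ennreal
  assumes "c \<noteq> 0" "c \<noteq> \<infinity>"
  shows "(c / a) * (b / c) = b / a"
proof -
  have "c * inverse c = 1"
    using assms ennreal_divide_self[of c] by (simp add: divide_ennreal_def less_top)
  moreover have "(c / a) * (b / c) = (c * inverse c) * (b / a)"
    by (simp add: divide_ennreal_def mult_ac)
  ultimately show ?thesis by simp
qed

text \<open>From \<open>x <= exp x\<close> with \<open>x = r powr p\<close>, the integrand is at
  most \<open>r powr (- p - 1)\<close>, whose integral over \<open>{u..}\<close> is
  \<open>u powr (- p) / p\<close>.\<close>

lemma ell_finite:
  assumes "p > 0" "u > 0"
  shows "ell p u < \<infinity>"
proof -
  have "ell p u \<le> (\<integral>\<^sup>+ r\<in>{u..}. ennreal (r powr (- p - 1)) \<partial>lborel)"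
    unfolding ell_def
  proof (rule nn_integral_mono)
    fix r :: real
    show "ennreal (exp (- (r powr p)) / r) * indicator {u..} r
        \<le> ennreal (r powr (- p - 1)) * indicator {u..} r"
    proof (cases "r \<ge> u")
      case True
      then have r: "r > 0" using assms by auto
      have "r powr p \<le> exp (r powr p)"
        using exp_ge_add_one_self[of "r powr p"] by linarith
      then have "exp (- (r powr p)) \<le> inverse (r powr p)"
        using r by (simp add: exp_minus le_imp_inverse_le)
      then have "exp (- (r powr p)) / r \<le> inverse (r powr p) / r"
        using r by (intro divide_right_mono) auto
      also have "\<dots> = r powr (- p - 1)"
        using r by (simp add: powr_diff powr_minus)
      finally show ?thesis by (intro mult_right_mono ennreal_leI) auto
    qed auto
  qed
  also have "\<dots> = ennreal (0 - (- (u powr (- p)) / p))"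
  proof (rule nn_integral_FTC_atLeast)
    show "((\<lambda>r. - (r powr (- p)) / p) \<longlongrightarrow> 0) at_top"
      using tendsto_divide[OF tendsto_minus[OF tendsto_neg_powr[OF _ filterlim_ident]] tendsto_const, of "- p" p] assms
      by simp
    fix r assume "u \<le> r"
    then have "r > 0" using assms by auto
    then show "DERIV (\<lambda>r. - (r powr (- p)) / p) r :> r powr (- p - 1)"
      using assms by (auto intro!: derivative_eq_intros)
  qed auto
  finally show ?thesis by (auto simp: top.not_eq_extremum intro: le_less_trans)
qed

lemma ell_pos:
  assumes "u > 0"
  shows "ell p u \<noteq> 0"
proof
  assume "ell p u = 0"
  then have "AE r in lborel. ennreal (exp (- (r powr p)) / r) * indicator {u..} r = 0"
    unfolding ell_def by (subst (asm) nn_integral_0_iff_AE) auto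
  \<comment> \<open>On \<open>{u..u + 1}\<close> the integrand is strictly positive because
    \<open>u > 0\<close>, so this interval would have to be a null set.\<close>
  then have "AE r in lborel. r \<notin> {u..u + 1}"
    by eventually_elim (use assms in \<open>auto split: split_indicator_asm\<close>)
  then have "emeasure lborel {u..u + 1} = 0"
    by (subst (asm) AE_iff_measurable[of "{u..u + 1}"]) auto
  then show False by simp
qed

lemma borel_measurable_ell [measurable]: "ell p \<in> borel_measurable borel"
proof -
  \<comment> \<open>The parameter \<open>u\<close> sits in the domain of integration. Moving it into
    a conditional makes the integrand jointly measurable in \<open>u\<close> and \<open>r\<close>,
    so that integrating out \<open>r\<close> preserves measurability.\<close>
  have "(\<lambda>u. \<integral>\<^sup>+ r. (if u \<le> r then ennreal (exp (- (r powr p)) / r) else 0) \<partial>lborel)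
      \<in> borel_measurable borel"
    by measurable
  also have "(\<lambda>u. \<integral>\<^sup>+ r. (if u \<le> r then ennreal (exp (- (r powr p)) / r) else 0) \<partial>lborel) = ell p"
    unfolding ell_def by (auto intro!: ext nn_integral_cong)
  finally show ?thesis .
qed

section \<open>The radial integral: change of variables, Laplace mixture and
  \<open>k_eps\<close>\<close>

text \<open>This is the unnormalised integral over \<open>R\<close> for fixed \<open>V = v\<close>,
  after substitution. The function \<open>H\<close> is a test function along a ray, and
  \<open>v\<close> enters only through a Laplace kernel, ready to be integrated against
  \<open>Q s\<close>.\<close>

definition radial_integral :: "real \<Rightarrow> real \<Rightarrow> (real \<Rightarrow> ennreal) \<Rightarrow> real \<Rightarrow> ennreal" where
  "radial_integral p \<epsilon> H v = (\<integral>\<^sup>+ t\<in>{\<epsilon>..}. H t * ennreal (exp (- (t powr p) * v) / t) \<partial>lborel)"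

lemma borel_measurable_radial_integral:
  assumes [measurable]: "H \<in> borel_measurable borel"
  shows "radial_integral p \<epsilon> H \<in> borel_measurable borel"
  unfolding radial_integral_def by measurable

text \<open>Substitute \<open>r = c * t\<close> with \<open>c = v powr (1 / p)\<close>. The measure
  dr/r is scale invariant, so the Jacobian \<open>c\<close> disappears; \<open>c powr p = v\<close>
  brings \<open>v\<close> into the exponent, and the lower limit \<open>c * \<epsilon>\<close>
  becomes \<open>\<epsilon>\<close>.\<close>

lemma radial_integral_scale:
  assumes p: "p > 0" and e: "\<epsilon> > 0" and v: "v > 0" and [measurable]: "H \<in> borel_measurable borel"
  shows "(\<integral>\<^sup>+ r\<in>{v powr (1 / p) * \<epsilon>..}. H (r * v powr (- 1 / p)) * ennreal (exp (- (r powr p)) / r) \<partial>lborel)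
    = radial_integral p \<epsilon> H v"
proof -
  define c where "c = v powr (1 / p)"
  have c: "c > 0" "v powr (- 1 / p) = inverse c"
    using v by (auto simp: c_def powr_minus[symmetric])
  have cp: "c powr p = v" using v p by (simp add: c_def powr_powr)
  have "(\<integral>\<^sup>+ r\<in>{c * \<epsilon>..}. H (r * inverse c) * ennreal (exp (- (r powr p)) / r) \<partial>lborel)
     = ennreal \<bar>c\<bar> * (\<integral>\<^sup>+ t. H ((0 + c * t) * inverse c) * ennreal (exp (- ((0 + c * t) powr p)) / (0 + c * t))
          * indicator {c * \<epsilon>..} (0 + c * t) \<partial>lborel)"
    using c by (intro nn_integral_real_affine) auto
  also have "\<dots> = (\<integral>\<^sup>+ t. ennreal \<bar>c\<bar> * (H ((0 + c * t) * inverse c) * ennreal (exp (- ((0 + c * t) powr p)) / (0 + c * t))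
          * indicator {c * \<epsilon>..} (0 + c * t)) \<partial>lborel)"
    by (rule nn_integral_cmult[symmetric]) measurable
  also have "\<dots> = radial_integral p \<epsilon> H v"
    unfolding radial_integral_def
  proof (rule nn_integral_cong)
    fix t :: real
    show "ennreal \<bar>c\<bar> * (H ((0 + c * t) * inverse c) * ennreal (exp (- ((0 + c * t) powr p)) / (0 + c * t))
          * indicator {c * \<epsilon>..} (0 + c * t)) = H t * ennreal (exp (- (t powr p) * v) / t) * indicator {\<epsilon>..} t"
    proof (cases "t \<ge> \<epsilon>")
      case True
      then have t: "t > 0" using e by auto
      have "ennreal c * ennreal (exp (- ((c * t) powr p)) / (c * t)) = ennreal (exp (- (t powr p) * v) / t)"
        using t c cp by (subst ennreal_mult[symmetric]) (auto simp: powr_mult mult.commute)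
      then show ?thesis
        using True c by (simp add: mult.left_commute[of "ennreal c"] field_simps)
    qed (use c in auto)
  qed
  finally show ?thesis unfolding c_def[symmetric] c(2) .
qed

lemma ell_scale:
  assumes "p > 0" "\<epsilon> > 0" "v > 0"
  shows "ell p (\<epsilon> * v powr (1 / p)) = radial_integral p \<epsilon> (\<lambda>_. 1) v"
  using radial_integral_scale[OF assms, of "\<lambda>_. 1"] by (simp add: ell_def mult.commute)

text \<open>By Tonelli the mixture over \<open>v\<close> may be taken inside, where it acts on the
  exponential alone and yields the Laplace representation of \<open>q\<close>.\<close>

lemma nn_integral_radial_integral:
  fixes q :: "real \<Rightarrow> real"
  assumes M: "prob_space M" "sets M = sets borel_pos"
    and e: "\<epsilon> > 0" and [measurable]: "H \<in> borel_measurable borel"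
    and q: "\<And>r. r > 0 \<Longrightarrow> q (r powr p) = (\<integral> v. exp (- (r powr p) * v) \<partial>M)"
  shows "(\<integral>\<^sup>+ v. radial_integral p \<epsilon> H v \<partial>M)
    = (\<integral>\<^sup>+ t\<in>{\<epsilon>..}. H t * ennreal (q (t powr p) / t) \<partial>lborel)"
proof -
  interpret prob_space M by (fact M(1))
  have [measurable_cong]: "sets M = sets borel_pos" by (fact M(2))
  have pos: "v > 0" if "v \<in> space M" for v
    using that sets_eq_imp_space_eq[OF M(2)] by simp
  have id[measurable]: "(\<lambda>v. v) \<in> borel_measurable M"
    unfolding measurable_cong_sets[OF M(2) refl] by (rule measurable_restrict_space1) simp
  interpret pair_sigma_finite M lborel by unfold_locales
  have "(\<integral>\<^sup>+ v. radial_integral p \<epsilon> H v \<partial>M) =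
     (\<integral>\<^sup>+ t. (\<integral>\<^sup>+ v. H t * ennreal (exp (- (t powr p) * v) / t) * indicator {\<epsilon>..} t \<partial>M) \<partial>lborel)"
    unfolding radial_integral_def by (rule Fubini'[symmetric]) measurable
  also have "\<dots> = (\<integral>\<^sup>+ t\<in>{\<epsilon>..}. H t * ennreal (q (t powr p) / t) \<partial>lborel)"
  proof (rule nn_integral_cong)
    fix t :: real
    show "(\<integral>\<^sup>+ v. H t * ennreal (exp (- (t powr p) * v) / t) * indicator {\<epsilon>..} t \<partial>M)
      = H t * ennreal (q (t powr p) / t) * indicator {\<epsilon>..} t"
    proof (cases "t \<ge> \<epsilon>")
      case True
      then have t: "t > 0" using e by auto
      \<comment> \<open>The representation of \<open>q\<close> is a Bochner integral. Integrability,
        from the bound 1 for \<open>v > 0\<close>, allows passing to it from the nonnegative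
        integral.\<close>
      have int: "integrable M (\<lambda>v. exp (- (t powr p) * v))"
        by (rule integrable_const_bound[of _ 1]) (auto intro!: AE_I2 dest: pos)
      have "(\<integral>\<^sup>+ v. ennreal (exp (- (t powr p) * v) / t) \<partial>M) = ennreal (\<integral> v. exp (- (t powr p) * v) / t \<partial>M)"
        using t int by (intro nn_integral_eq_integral) auto
      also have "\<dots> = ennreal (q (t powr p) / t)"
        using q[OF t] by simp
      finally show ?thesis using True
        by (simp add: nn_integral_cmult)
    qed auto
  qed
  finally show ?thesis .
qed

text \<open>The case \<open>H = 1\<close> of the mixture identity, combined with
  \<open>ell_scale\<close>. It is what makes \<open>k_eps\<close> the normalising constant of
  \<open>G_V\<close>; both sides may be infinite.\<close>

lemma k_eps_eq_nn_integral_ell: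
  assumes "p > 0" "\<epsilon> > 0" and M: "prob_space M" "sets M = sets borel_pos"
    and q: "\<And>r. r > 0 \<Longrightarrow> q (r powr p) s = (\<integral> v. exp (- (r powr p) * v) \<partial>M)"
  shows "k_eps p \<epsilon> q s = (\<integral>\<^sup>+ v. ell p (\<epsilon> * v powr (1 / p)) \<partial>M)"
proof -
  have "(\<integral>\<^sup>+ v. ell p (\<epsilon> * v powr (1 / p)) \<partial>M) = (\<integral>\<^sup>+ v. radial_integral p \<epsilon> (\<lambda>_. 1) v \<partial>M)"
    using sets_eq_imp_space_eq[OF M(2)] by (intro nn_integral_cong ell_scale assms) auto
  then show ?thesis
    using nn_integral_radial_integral[OF M assms(2), of "\<lambda>_. 1" "\<lambda>r. q r s" p] q
    by (simp add: k_eps_def)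
qed

text \<open>A vanishing integral would force \<open>ell\<close> to vanish almost everywhere, but
  \<open>ell\<close> is nonzero at every positive argument and \<open>M\<close> has mass
  one.\<close>

lemma k_eps_pos:
  assumes "p > 0" "\<epsilon> > 0" and M: "prob_space M" "sets M = sets borel_pos"
    and q: "\<And>r. r > 0 \<Longrightarrow> q (r powr p) s = (\<integral> v. exp (- (r powr p) * v) \<partial>M)"
  shows "k_eps p \<epsilon> q s \<noteq> 0"
proof
  interpret prob_space M by (fact M(1))
  have [measurable_cong]: "sets M = sets borel_pos" by (fact M(2))
  have id[measurable]: "(\<lambda>v. v) \<in> borel_measurable M"
    unfolding measurable_cong_sets[OF M(2) refl] by (rule measurable_restrict_space1) simp
  assume "k_eps p \<epsilon> q s = 0"
  then have "AE v in M. ell p (\<epsilon> * v powr (1 / p)) = 0"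
    using k_eps_eq_nn_integral_ell[where q=q, OF assms] by (simp add: nn_integral_0_iff_AE)
  moreover have "AE v in M. v > 0"
    using sets_eq_imp_space_eq[OF M(2)] by (intro AE_I2) auto
  ultimately have "AE v in M. False"
    by eventually_elim (use ell_pos assms in auto)
  then show False by simp
qed

section \<open>The kernels \<open>G_R\<close> and \<open>G_V\<close>: normalisation, measurability
  and composition\<close>

lemma prob_space_G_R:
  assumes "p > 0" "a > 0"
  shows "prob_space (G_R p a)"
proof
  have "emeasure (G_R p a) (space (G_R p a)) =
    (\<integral>\<^sup>+ r. indicator {a..} r * ennreal (exp (- (r powr p)) / r) / ell p a \<partial>restrict_space lborel {0<..})"
    unfolding G_R_def by (subst emeasure_density)
      (auto intro!: nn_integral_cong measurable_restrict_space1 split: split_indicator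
        simp: sets_restrict_space space_restrict_space)
  \<comment> \<open>Since \<open>a > 0\<close>, the indicator of \<open>{a..}\<close> already
    confines \<open>r\<close> to the positive half-line, so the restricted Lebesgue measure can be
    replaced by \<open>lborel\<close>.\<close>
  also have "\<dots> = (\<integral>\<^sup>+ r. inverse (ell p a) * (ennreal (exp (- (r powr p)) / r) * indicator {a..} r) \<partial>lborel)"
    using assms(2) by (subst nn_integral_restrict_space)
      (auto intro!: nn_integral_cong simp: divide_ennreal_def mult.commute split: split_indicator)
  also have "\<dots> = inverse (ell p a) * ell p a"
    unfolding ell_def by (rule nn_integral_cmult) measurable
  also have "\<dots> = 1"
    using ell_finite[OF assms] ell_pos[OF assms(2)] ennreal_divide_self[of "ell p a"]
    by (simp add: divide_ennreal_def mult.commute less_top)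
  finally show "emeasure (G_R p a) (space (G_R p a)) = 1" .
qed

lemma nn_integral_G_R:
  assumes a: "a > 0" and [measurable]: "F \<in> borel_measurable borel"
  shows "(\<integral>\<^sup>+ r. F r \<partial>G_R p a) = (\<integral>\<^sup>+ r\<in>{a..}. F r * ennreal (exp (- (r powr p)) / r) \<partial>lborel) / ell p a"
proof -
  have "(\<integral>\<^sup>+ r. F r \<partial>G_R p a) =
    (\<integral>\<^sup>+ r. (indicator {a..} r * ennreal (exp (- (r powr p)) / r) / ell p a) * F r \<partial>restrict_space lborel {0<..})"
    unfolding G_R_def by (subst nn_integral_density) (auto simp: measurable_restrict_space1)
  also have "\<dots> = (\<integral>\<^sup>+ r. (F r * ennreal (exp (- (r powr p)) / r) * indicator {a..} r) / ell p a \<partial>lborel)"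
    using a by (subst nn_integral_restrict_space)
      (auto intro!: nn_integral_cong simp: divide_ennreal_def mult_ac split: split_indicator)
  also have "\<dots> = (\<integral>\<^sup>+ r\<in>{a..}. F r * ennreal (exp (- (r powr p)) / r) \<partial>lborel) / ell p a"
    by (rule nn_integral_divide) measurable
  finally show ?thesis .
qed

lemma measurable_G_R:
  assumes p: "p > 0" and a: "a \<in> borel_measurable N" "\<And>x. x \<in> space N \<Longrightarrow> a x > 0"
  shows "(\<lambda>x. G_R p (a x)) \<in> N \<rightarrow>\<^sub>M subprob_algebra borel_pos"
proof (rule measurable_subprob_algebra)
  fix x assume "x \<in> space N"
  then show "subprob_space (G_R p (a x))"
    by (intro prob_space_imp_subprob_space prob_space_G_R p a)
next
  fix x assume "x \<in> space N"
  show "sets (G_R p (a x)) = sets borel_pos"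
    unfolding G_R_def by (simp cong: sets_restrict_space_cong)
next
  note a(1)[measurable]
  fix E assume "E \<in> sets borel_pos"
  then have E[measurable]: "E \<in> sets borel"
    by (auto simp: sets_restrict_space)
  have sE: "E \<in> sets (G_R p (a x))" for x
    using \<open>E \<in> sets borel_pos\<close> unfolding G_R_def by (simp cong: sets_restrict_space_cong)
  have "(\<lambda>x. (\<integral>\<^sup>+ r. (if a x \<le> r then indicator E r * ennreal (exp (- (r powr p)) / r) else 0) \<partial>lborel) / ell p (a x))
    \<in> borel_measurable N"
    by measurable
  also have "?this \<longleftrightarrow> (\<lambda>x. emeasure (G_R p (a x)) E) \<in> borel_measurable N"
  proof (rule measurable_cong)
    fix x assume x: "x \<in> space N"
    have "emeasure (G_R p (a x)) E = (\<integral>\<^sup>+ r. indicator E r \<partial>G_R p (a x))"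
      using sE by simp
    also have "\<dots> = (\<integral>\<^sup>+ r. (if a x \<le> r then indicator E r * ennreal (exp (- (r powr p)) / r) else 0) \<partial>lborel) / ell p (a x)"
      by (subst nn_integral_G_R[OF a(2)[OF x]]) (auto intro!: nn_integral_cong arg_cong2[where f="(/)"])
    finally show "(\<integral>\<^sup>+ r. (if a x \<le> r then indicator E r * ennreal (exp (- (r powr p)) / r) else 0) \<partial>lborel) / ell p (a x)
      = emeasure (G_R p (a x)) E" ..
  qed
  finally show "(\<lambda>x. emeasure (G_R p (a x)) E) \<in> borel_measurable N" .
qed

text \<open>With \<open>B = UNIV\<close> the integrand of the polar measure is exactly that of
  \<open>k_eps\<close>, so its joint measurability carries over after integrating out the
  radius.\<close>

lemma borel_measurable_k_eps:
  fixes q :: "real \<Rightarrow> 'a::euclidean_space \<Rightarrow> real"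
  assumes q: "(\<lambda>(r, s). q r s) \<in> borel_measurable (borel_pos \<Otimes>\<^sub>M borel_sphere)" and "\<epsilon> > 0"
  shows "k_eps p \<epsilon> q \<in> borel_measurable borel_sphere"
proof -
  have "(\<lambda>(s, r). indicator UNIV (r *\<^sub>R s) * ennreal (q (r powr p) s / r) * indicator {\<epsilon>..} r)
           \<in> borel_measurable (borel_sphere \<Otimes>\<^sub>M lborel)"
    by (rule polar_measure_integrand_measurable[OF refl q]) (use assms(2) in auto)
  from lborel.borel_measurable_nn_integral[OF this] show ?thesis
    unfolding k_eps_def by simp
qed

text \<open>The target is \<open>subprob_algebra\<close>, not \<open>prob_algebra\<close>, because
  \<open>G_V\<close> is the zero measure at directions where \<open>k_eps\<close> is
  infinite.\<close>

lemma measurable_G_V: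
  fixes q :: "real \<Rightarrow> 'a::euclidean_space \<Rightarrow> real"
  assumes p: "p > 0" and e: "\<epsilon> > 0"
    and q: "(\<lambda>(r, s). q r s) \<in> borel_measurable (borel_pos \<Otimes>\<^sub>M borel_sphere)"
    and Q: "Q \<in> borel_sphere \<rightarrow>\<^sub>M prob_algebra borel_pos"
    and qQ: "\<And>r s. r > 0 \<Longrightarrow> s \<in> sphere 0 1 \<Longrightarrow>
           q (r powr p) s = (\<integral> v. exp (- (r powr p) * v) \<partial>Q s)"
  shows "G_V p \<epsilon> q Q \<in> borel_sphere \<rightarrow>\<^sub>M subprob_algebra borel_pos"
proof -
  have Qs: "prob_space (Q s)" "sets (Q s) = sets borel_pos" if "s \<in> sphere 0 1" for s
    using measurable_space[OF Q, of s] that by (auto simp: space_prob_algebra)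
  note k[measurable] = borel_measurable_k_eps[OF q e, of p]
  have ell1: "(\<lambda>v. ell p (\<epsilon> * v powr (1 / p))) \<in> borel_measurable borel_pos"
    by (rule measurable_restrict_space1) measurable
  have ell2: "(\<lambda>v. ell p (\<epsilon> * v powr (1 / p)) / c) \<in> borel_measurable (Q s)" if "s \<in> sphere 0 1" for s c
    using ell1 unfolding measurable_cong_sets[OF Qs(2)[OF that] refl] by measurable
  show ?thesis
  proof (rule measurable_subprob_algebra)
    fix s :: 'a assume "s \<in> space borel_sphere"
    then have s: "s \<in> sphere 0 1" by simp
    interpret prob_space "Q s" by (rule Qs[OF s])
    show "sets (G_V p \<epsilon> q Q s) = sets borel_pos"
      unfolding G_V_def using Qs(2)[OF s] by simp
    show "subprob_space (G_V p \<epsilon> q Q s)"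
    proof
      have "emeasure (G_V p \<epsilon> q Q s) (space (G_V p \<epsilon> q Q s)) =
        (\<integral>\<^sup>+ v. ell p (\<epsilon> * v powr (1 / p)) / k_eps p \<epsilon> q s \<partial>Q s)"
        unfolding G_V_def by (subst emeasure_density) (auto intro!: nn_integral_cong ell2[OF s])
      also have "\<dots> = (\<integral>\<^sup>+ v. ell p (\<epsilon> * v powr (1 / p)) \<partial>Q s) / k_eps p \<epsilon> q s"
        using ell1 by (intro nn_integral_divide) (simp add: measurable_cong_sets[OF Qs(2)[OF s] refl])
      also have "\<dots> = k_eps p \<epsilon> q s / k_eps p \<epsilon> q s"
        using k_eps_eq_nn_integral_ell[OF p e Qs[OF s], of q s] qQ s by simp
      \<comment> \<open>The quotient is 1 for positive finite \<open>k_eps\<close> and 0 by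
        convention when \<open>k_eps\<close> is 0 or infinite.\<close>
      also have "\<dots> \<le> 1"
        by (cases "k_eps p \<epsilon> q s = 0 \<or> k_eps p \<epsilon> q s = \<infinity>") (auto simp: ennreal_divide_self less_top)
      finally show "emeasure (G_V p \<epsilon> q Q s) (space (G_V p \<epsilon> q Q s)) \<le> 1" .
      show "space (G_V p \<epsilon> q Q s) \<noteq> {}"
        unfolding G_V_def using not_empty by simp
    qed
  next
    fix E assume E[measurable]: "E \<in> sets borel_pos"
    have m: "(\<lambda>(s, v). ell p (\<epsilon> * v powr (1 / p)) / k_eps p \<epsilon> q s * indicator E v)
        \<in> borel_measurable (borel_sphere \<Otimes>\<^sub>M borel_pos)"
      using ell1 by measurable
    have "(\<lambda>s. \<integral>\<^sup>+ v. ell p (\<epsilon> * v powr (1 / p)) / k_eps p \<epsilon> q s * indicator E v \<partial>Q s)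
      \<in> borel_measurable borel_sphere"
      using nn_integral_measurable_subprob_algebra2[OF m measurable_prob_algebraD[OF Q]] .
    also have "?this \<longleftrightarrow> (\<lambda>s. emeasure (G_V p \<epsilon> q Q s) E) \<in> borel_measurable borel_sphere"
    proof (rule measurable_cong)
      fix s :: 'a assume "s \<in> space borel_sphere"
      then have s: "s \<in> sphere 0 1" by simp
      show "(\<integral>\<^sup>+ v. ell p (\<epsilon> * v powr (1 / p)) / k_eps p \<epsilon> q s * indicator E v \<partial>Q s)
        = emeasure (G_V p \<epsilon> q Q s) E"
        unfolding G_V_def using Qs[OF s] E by (subst emeasure_density) (auto intro!: ell2[OF s])
    qed
    finally show "(\<lambda>s. emeasure (G_V p \<epsilon> q Q s) E) \<in> borel_measurable borel_sphere" .
  qed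
qed

text \<open>For a fixed direction with finite \<open>k_eps\<close>, this says that the radius
  \<open>R * V powr (- 1 / p)\<close> has density \<open>q (t powr p) s / t\<close> on
  \<open>{\<epsilon>..}\<close>, normalised by \<open>k_eps\<close>. If \<open>k_eps\<close> is
  infinite, both sides are 0.\<close>

lemma nn_integral_G_V_G_R:
  assumes p: "p > 0" and e: "\<epsilon> > 0" and M: "prob_space (Q s)" "sets (Q s) = sets borel_pos"
    and q: "\<And>r. r > 0 \<Longrightarrow> q (r powr p) s = (\<integral> v. exp (- (r powr p) * v) \<partial>Q s)"
    and H[measurable]: "H \<in> borel_measurable borel"
  shows "(\<integral>\<^sup>+ v. (\<integral>\<^sup>+ r. H (r * v powr (- 1 / p)) \<partial>G_R p (v powr (1 / p) * \<epsilon>)) \<partial>G_V p \<epsilon> q Q s)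
    = (\<integral>\<^sup>+ t\<in>{\<epsilon>..}. H t * ennreal (q (t powr p) s / t) \<partial>lborel) / k_eps p \<epsilon> q s"
proof -
  have [measurable_cong]: "sets (Q s) = sets borel_pos" by (fact M(2))
  have id[measurable]: "(\<lambda>v. v) \<in> borel_measurable (Q s)"
    unfolding measurable_cong_sets[OF M(2) refl] by (rule measurable_restrict_space1) simp
  note borel_measurable_radial_integral[OF H, measurable]
  have pos: "v > 0" if "v \<in> space (Q s)" for v
    using that sets_eq_imp_space_eq[OF M(2)] by simp
  let ?l = "\<lambda>v. ell p (\<epsilon> * v powr (1 / p))"
  have R: "(\<integral>\<^sup>+ r. H (r * v powr (- 1 / p)) \<partial>G_R p (v powr (1 / p) * \<epsilon>)) = radial_integral p \<epsilon> H v / ?l v"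
    if v: "v > 0" for v
    using v e radial_integral_scale[OF p e v H]
    by (subst nn_integral_G_R) (auto simp: mult.commute[of \<epsilon>])
  have "(\<integral>\<^sup>+ v. (\<integral>\<^sup>+ r. H (r * v powr (- 1 / p)) \<partial>G_R p (v powr (1 / p) * \<epsilon>)) \<partial>G_V p \<epsilon> q Q s)
    = (\<integral>\<^sup>+ v. radial_integral p \<epsilon> H v / ?l v \<partial>G_V p \<epsilon> q Q s)"
    using pos by (intro nn_integral_cong R) (simp add: G_V_def)
  also have "\<dots> = (\<integral>\<^sup>+ v. (?l v / k_eps p \<epsilon> q s) * (radial_integral p \<epsilon> H v / ?l v) \<partial>Q s)"
    unfolding G_V_def by (subst nn_integral_density) auto
  also have "\<dots> = (\<integral>\<^sup>+ v. radial_integral p \<epsilon> H v / k_eps p \<epsilon> q s \<partial>Q s)"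
  proof (rule nn_integral_cong)
    fix v assume "v \<in> space (Q s)"
    then have l: "\<epsilon> * v powr (1 / p) > 0" using pos[of v] e by simp
    show "(?l v / k_eps p \<epsilon> q s) * (radial_integral p \<epsilon> H v / ?l v)
        = radial_integral p \<epsilon> H v / k_eps p \<epsilon> q s"
      using ell_finite[OF p l] ell_pos[OF l]
      by (intro ennreal_divide_mult_divide_cancel) auto
  qed
  also have "\<dots> = (\<integral>\<^sup>+ v. radial_integral p \<epsilon> H v \<partial>Q s) / k_eps p \<epsilon> q s"
    by (rule nn_integral_divide) measurable
  also have "(\<integral>\<^sup>+ v. radial_integral p \<epsilon> H v \<partial>Q s)
      = (\<integral>\<^sup>+ t\<in>{\<epsilon>..}. H t * ennreal (q (t powr p) s / t) \<partial>lborel)"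
    by (rule nn_integral_radial_integral[where q="\<lambda>r. q r s", OF M e H q])
  finally show ?thesis .
qed

section \<open>The law of \<open>W\<close>\<close>

theorem proposition2:
  fixes p \<epsilon> :: real
    and \<sigma> :: "'a::euclidean_space measure"
    and q :: "real \<Rightarrow> 'a \<Rightarrow> real"
    and Q :: "'a \<Rightarrow> real measure"
    and P :: "'w measure"
    and S :: "'w \<Rightarrow> 'a" and V R :: "'w \<Rightarrow> real"
  assumes "p > 0" and "\<epsilon> > 0"
    and "finite_measure \<sigma>" and "sets \<sigma> = sets borel_sphere" and "emeasure \<sigma> (space \<sigma>) \<noteq> 0"
    and "(\<lambda>(r, s). q r s) \<in> borel_measurable (borel_pos \<Otimes>\<^sub>M borel_sphere)"
    and "\<And>r s. r > 0 \<Longrightarrow> s \<in> sphere 0 1 \<Longrightarrow> q r s \<ge> 0"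
    and "\<And>s. s \<in> sphere 0 1 \<Longrightarrow> ((\<lambda>r. q r s) \<longlongrightarrow> 1) (at_right 0)"
    and "\<And>s. s \<in> sphere 0 1 \<Longrightarrow> completely_monotone (\<lambda>r. q r s)"
    and "levy_measure (gamma_nu p \<sigma> q)"
    and "(\<integral>\<^sup>+ x. ennreal (min (norm x) 1) \<partial>gamma_nu p \<sigma> q) < \<infinity>"
    and "Q \<in> borel_sphere \<rightarrow>\<^sub>M prob_algebra borel_pos"
    and "\<And>r s. r > 0 \<Longrightarrow> s \<in> sphere 0 1 \<Longrightarrow>
           q (r powr p) s = (\<integral> v. exp (- (r powr p) * v) \<partial>Q s)"
    and "(\<integral>\<^sup>+ s. (\<integral>\<^sup>+ v\<in>{0<..1}. ennreal (ln (1 / v)) \<partial>Q s) \<partial>\<sigma>) < \<infinity>"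
    and "prob_space P"
    and "S \<in> P \<rightarrow>\<^sub>M borel_sphere" and "distr P borel_sphere S = sigma_p p \<epsilon> \<sigma> q"
    and "has_cond_distr P S borel_sphere V borel_pos (G_V p \<epsilon> q Q)"
    and "has_cond_distr P (\<lambda>\<omega>. (S \<omega>, V \<omega>)) (borel_sphere \<Otimes>\<^sub>M borel_pos) R borel_pos
           (\<lambda>(s, v). G_R p (v powr (1 / p) * \<epsilon>))"
  shows "distr P borel (\<lambda>\<omega>. (R \<omega> * V \<omega> powr (- 1 / p)) *\<^sub>R S \<omega>) = nu_tilde_prob p \<epsilon> \<sigma> q"
proof (rule measure_eqI)
  note p = assms(1) and e = assms(2) and sig = assms(4) and q = assms(6) and Q = assms(12)
    and qQ = assms(13) and P = assms(15) and dS = assms(17) and cV = assms(18) and cR = assms(19)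
  interpret prob_space P by (fact P)
  have [measurable_cong]: "sets \<sigma> = sets borel_sphere" by (fact sig)
  have S[measurable]: "S \<in> P \<rightarrow>\<^sub>M borel_sphere" by fact
  have V[measurable]: "V \<in> P \<rightarrow>\<^sub>M borel_pos" and R[measurable]: "R \<in> P \<rightarrow>\<^sub>M borel_pos"
    using cV cR by (auto simp: has_cond_distr_def)
  have bor: "(\<lambda>x. x) \<in> restrict_space borel X \<rightarrow>\<^sub>M borel" for X :: "'b::topological_space set"
    by (rule measurable_restrict_space1) simp
  have SVR: "S \<in> P \<rightarrow>\<^sub>M borel" "V \<in> P \<rightarrow>\<^sub>M borel" "R \<in> P \<rightarrow>\<^sub>M borel"
    using measurable_compose[OF S bor] measurable_compose[OF V bor] measurable_compose[OF R bor] by auto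
  have spc: "space \<sigma> = sphere 0 1" using sets_eq_imp_space_eq[OF sig] by simp
  have Qs: "prob_space (Q s)" "sets (Q s) = sets borel_pos" if "s \<in> sphere 0 1" for s
    using measurable_space[OF Q, of s] that by (auto simp: space_prob_algebra)
  have I: "{\<epsilon>..} \<in> sets borel" "{\<epsilon>..} \<subseteq> {0<..}" using e by auto
  let ?k = "k_eps p \<epsilon> q" and ?L = "lam p \<epsilon> \<sigma> q"
  let ?N = "\<lambda>B s. \<integral>\<^sup>+ t\<in>{\<epsilon>..}. indicator B (t *\<^sub>R s) * ennreal (q (t powr p) s / t) \<partial>lborel"
  have k[measurable]: "?k \<in> borel_measurable \<sigma>"
    unfolding measurable_cong_sets[OF sig refl] by (rule borel_measurable_k_eps[OF q e])
  have kpos: "?k s \<noteq> 0" if "s \<in> sphere 0 1" for s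
    by (rule k_eps_pos[OF p e Qs[OF that]]) (use qQ that in auto)
  have nu: "emeasure (nu_tilde p \<epsilon> \<sigma> q) B = (\<integral>\<^sup>+ s. ?N B s \<partial>\<sigma>)" if "B \<in> sets borel" for B
    unfolding nu_tilde_def by (rule emeasure_polar_measure[OF sig q I that])
  have Lk: "?L = (\<integral>\<^sup>+ s. ?k s \<partial>\<sigma>)"
    unfolding lam_def by (simp add: nu k_eps_def)
  have "1 = emeasure (distr P borel_sphere S) (space borel_sphere)"
    using prob_space.emeasure_space_1[OF prob_space_distr[OF S]] by simp
  also have "\<dots> = (\<integral>\<^sup>+ s. ?k s / ?L \<partial>\<sigma>)"
    unfolding dS sigma_p_def using spc sets.top[of \<sigma>]
    by (subst emeasure_density) (auto intro!: nn_integral_cong)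
  also have "\<dots> = ?L / ?L"
    unfolding Lk by (rule nn_integral_divide) measurable
  \<comment> \<open>In \<^typ>\<open>ennreal\<close> both \<open>0 / 0\<close> and \<open>\<infinity> / \<infinity>\<close> are \<open>0\<close>, so the total mass \<open>1\<close> of \<open>\<sigma>\<^sub>p\<close> excludes both.\<close>
  finally have L: "?L \<noteq> 0" "?L \<noteq> \<infinity>" by (auto simp: divide_ennreal_def)
  \<comment> \<open>The integral of \<open>k_eps\<close> is the finite number \<open>lam\<close>, so
    the directions with infinite \<open>k_eps\<close> form a null set for
    \<open>\<sigma>\<close>.\<close>
  have kfin: "AE s in \<sigma>. ?k s \<noteq> \<infinity>"
    using L(2) unfolding Lk by (intro nn_integral_PInf_AE) auto
  show "sets (distr P borel (\<lambda>\<omega>. (R \<omega> * V \<omega> powr (- 1 / p)) *\<^sub>R S \<omega>)) = sets (nu_tilde_prob p \<epsilon> \<sigma> q)"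
    using sets.sigma_sets_eq[of "borel :: 'a measure"]
    by (simp add: nu_tilde_prob_def nu_tilde_def polar_measure_def)
  fix B assume "B \<in> sets (distr P borel (\<lambda>\<omega>. (R \<omega> * V \<omega> powr (- 1 / p)) *\<^sub>R S \<omega>))"
  then have B[measurable]: "B \<in> sets borel" by simp
  \<comment> \<open>The nesting of the pairs matches the order of conditioning: \<open>R\<close> is
    conditioned on the pair of \<open>S\<close> and \<open>V\<close>, and \<open>V\<close> on
    \<open>S\<close>.\<close>
  define F where "F = (\<lambda>((s, v), r). indicator B ((r * v powr (- 1 / p)) *\<^sub>R s) :: ennreal)"
  have F: "F \<in> borel_measurable ((borel_sphere \<Otimes>\<^sub>M borel_pos) \<Otimes>\<^sub>M borel_pos)"
  proof -
    have [measurable]: "(\<lambda>x. fst (fst x)) \<in> (borel_sphere \<Otimes>\<^sub>M borel_pos) \<Otimes>\<^sub>M borel_pos \<rightarrow>\<^sub>M (borel :: 'a measure)"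
      "(\<lambda>x. snd (fst x)) \<in> ((borel_sphere :: 'a measure) \<Otimes>\<^sub>M borel_pos) \<Otimes>\<^sub>M borel_pos \<rightarrow>\<^sub>M borel"
      "(\<lambda>x. snd x) \<in> ((borel_sphere :: 'a measure) \<Otimes>\<^sub>M borel_pos) \<Otimes>\<^sub>M borel_pos \<rightarrow>\<^sub>M borel"
      by (auto intro!: measurable_compose[OF _ bor] measurable_compose[OF measurable_fst measurable_fst]
          measurable_compose[OF measurable_fst measurable_snd] measurable_snd)
    show ?thesis unfolding F_def split_beta by measurable
  qed
  let ?K = "\<lambda>(s :: 'a, v). G_R p (v powr (1 / p) * \<epsilon>)"
  have K: "?K \<in> borel_sphere \<Otimes>\<^sub>M borel_pos \<rightarrow>\<^sub>M subprob_algebra borel_pos"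
  proof -
    have [measurable]: "(\<lambda>x. snd x) \<in> (borel_sphere :: 'a measure) \<Otimes>\<^sub>M borel_pos \<rightarrow>\<^sub>M borel"
      by (rule measurable_compose[OF measurable_snd bor])
    show ?thesis
      unfolding split_beta using e by (intro measurable_G_R p) (auto simp: space_pair_measure)
  qed
  \<comment> \<open>\<open>J\<close> is the test function with \<open>R\<close> integrated out. Its
    measurability in the pair of \<open>S\<close> and \<open>V\<close> permits a second
    disintegration, of \<open>V\<close> given \<open>S\<close>.\<close>
  define J where "J x = (\<integral>\<^sup>+ r. F (x, r) \<partial>?K x)" for x
  have J: "J \<in> borel_measurable (borel_sphere \<Otimes>\<^sub>M borel_pos)"
    unfolding J_def by (rule nn_integral_measurable_subprob_algebra2[OF _ K]) (use F in simp)
  have W: "(\<lambda>\<omega>. (R \<omega> * V \<omega> powr (- 1 / p)) *\<^sub>R S \<omega>) \<in> P \<rightarrow>\<^sub>M borel"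
    using SVR by measurable
  have "emeasure (distr P borel (\<lambda>\<omega>. (R \<omega> * V \<omega> powr (- 1 / p)) *\<^sub>R S \<omega>)) B
      = (\<integral>\<^sup>+ \<omega>. F ((S \<omega>, V \<omega>), R \<omega>) \<partial>P)"
    using W by (subst nn_integral_indicator[symmetric], simp, subst nn_integral_distr) (auto simp: F_def)
  also have "\<dots> = (\<integral>\<^sup>+ x. J x \<partial>distr P (borel_sphere \<Otimes>\<^sub>M borel_pos) (\<lambda>\<omega>. (S \<omega>, V \<omega>)))"
    unfolding J_def by (rule has_cond_distr_nn_integral[OF P cR K F])
  also have "\<dots> = (\<integral>\<^sup>+ \<omega>. J (S \<omega>, V \<omega>) \<partial>P)"
    using J by (subst nn_integral_distr) auto
  also have "\<dots> = (\<integral>\<^sup>+ s. (\<integral>\<^sup>+ v. J (s, v) \<partial>G_V p \<epsilon> q Q s) \<partial>sigma_p p \<epsilon> \<sigma> q)"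
    unfolding dS[symmetric]
    by (rule has_cond_distr_nn_integral[OF P cV measurable_G_V[OF p e q Q qQ] J])
  also have "\<dots> = (\<integral>\<^sup>+ s. ?N B s / ?k s \<partial>sigma_p p \<epsilon> \<sigma> q)"
  proof (rule nn_integral_cong)
    fix s assume "s \<in> space (sigma_p p \<epsilon> \<sigma> q)"
    then have s: "s \<in> sphere 0 1" by (simp add: sigma_p_def spc)
    \<comment> \<open>On the ray through \<open>s\<close>, the event that \<open>W\<close> lies in
      \<open>B\<close> depends only on the radius \<open>t\<close>, which gives the test function
      \<open>H\<close>.\<close>
    show "(\<integral>\<^sup>+ v. J (s, v) \<partial>G_V p \<epsilon> q Q s) = ?N B s / ?k s"
      using nn_integral_G_V_G_R[where H="\<lambda>t. indicator B (t *\<^sub>R s)" and Q=Q and q=q, OF p e Qs[OF s]] qQ s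
      by (simp add: J_def F_def)
  qed
  also have "\<dots> = (\<integral>\<^sup>+ s. ?k s / ?L * (?N B s / ?k s) \<partial>\<sigma>)"
  proof -
    have N: "?N B \<in> borel_measurable \<sigma>"
      using lborel.borel_measurable_nn_integral[OF polar_measure_integrand_measurable[OF sig q I B, of p]]
      by simp
    show ?thesis
      unfolding sigma_p_def
      by (intro nn_integral_density borel_measurable_divide_ennreal borel_measurable_const k N)
  qed
  \<comment> \<open>The cancellation of \<open>k_eps\<close> holds only almost everywhere:
    positivity is available at every direction, finiteness only outside a null set.\<close>
  also have "\<dots> = (\<integral>\<^sup>+ s. 1 / ?L * ?N B s \<partial>\<sigma>)"
  proof (rule nn_integral_cong_AE)
    show "AE s in \<sigma>. ?k s / ?L * (?N B s / ?k s) = 1 / ?L * ?N B s"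
      using kfin AE_space
    proof eventually_elim
      fix s assume s: "?k s \<noteq> \<infinity>" "s \<in> space \<sigma>"
      then have "?k s / ?L * (?N B s / ?k s) = ?N B s / ?L"
        using kpos[of s] spc by (intro ennreal_divide_mult_divide_cancel) auto
      then show "?k s / ?L * (?N B s / ?k s) = 1 / ?L * ?N B s"
        by (simp add: divide_ennreal_def mult.commute)
    qed
  qed
  also have "\<dots> = 1 / ?L * (\<integral>\<^sup>+ s. ?N B s \<partial>\<sigma>)"
    using lborel.borel_measurable_nn_integral[OF polar_measure_integrand_measurable[OF sig q I B, of p]]
    by (intro nn_integral_cmult) simp
  also have "\<dots> = emeasure (nu_tilde_prob p \<epsilon> \<sigma> q) B"
    unfolding nu_tilde_prob_def by (simp add: nu[OF B])
  finally show "emeasure (distr P borel (\<lambda>\<omega>. (R \<omega> * V \<omega> powr (- 1 / p)) *\<^sub>R S \<omega>)) B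
      = emeasure (nu_tilde_prob p \<epsilon> \<sigma> q) B" .
qed

end
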